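(* Let $k\geq 5$, $t\geq 1$ and $\beta\ge0$ be integers with $\gamma=1+\beta\leq k-2$, and let $n$ be sufficiently large (depending on $k,t,\gamma$). Let $\mathcal{F}\subseteq\binom{[n]}{k}$ be a $(1,t)$-union intersecting family with $\ell(\mathcal{F})\geq\gamma$. Then $$|\mathcal{F}|\leq\binom{n-1}{k-1}-\binom{n-k}{k-1}+\binom{n-k-\gamma}{k-\gamma-1}+\gamma t.$$ Equality holds if and only if $\mathcal{F}$ is isomorphic to a family $\mathcal{J}^{1,t}_{\gamma}$ (as defined in the context).
   Context: $\binom{[n]}{k}$ is the family of $k$-subsets of $[n]$. A family is intersecting if any two members meet. $\mathcal{F}$ is $(1,t)$-union intersecting if for any pairwise distinct $A_1,\ldots,A_{t+1}\in\mathcal{F}$, $A_1\cap(\bigcup_{i=2}^{t+1}A_i)\neq\varnothing$. $\ell(\mathcal{F})$ is the minimum number of members of $\mathcal{F}$ whose removal leaves an intersecting family. Two families are isomorphic if some permutation of $[n]$ maps one onto the other. Construction $\mathcal{J}^{1,t}_i$ ($1\le i\le k-1$): take an $(i+1)$-set $J=\{1,x_1,\ldots,x_i\}\subseteq[n]$, a $(k-1)$-set $E\subseteq[n]\setminus J$, and let $A_j=E\cup\{x_j\}$ for $j\le i$. Let $\mathcal{S}_1(A_1,\ldots,A_i:1)=\{A\in\binom{[n]}{k}:1\in A,\ A\cap A_j\ne\varnothing\text{ for all }j\le i\}$. For each $j\le i$, let $\mathcal{B}_j$ be a family of $t-1$ distinct $k$-sets $B$ with $B\cap E=\varnothing$ and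 $J\setminus B=\{x_j\}$. Then $\mathcal{J}^{1,t}_i=\mathcal{S}_1(A_1,\ldots,A_i:1)\cup\{A_1,\ldots,A_i\}\cup\mathcal{B}_1\cup\cdots\cup\mathcal{B}_i$. *)

theory Defs
  imports "HOL-Library.Ramsey" "HOL-Combinatorics.Permutations"
begin

text \<open>The ground set $[n]$ is \<open>{1..n}\<close>, and its family of $k$-subsets is
  \<^term>\<open>nsets {1..n} k\<close>.\<close>

definition intersecting :: "'a set set \<Rightarrow> bool" where
  "intersecting F \<longleftrightarrow> (\<forall>A\<in>F. \<forall>B\<in>F. A \<inter> B \<noteq> {})"

definition union_intersecting_1 :: "nat \<Rightarrow> 'a set set \<Rightarrow> bool" where
  "union_intersecting_1 t F \<longleftrightarrow>
     (\<forall>A :: nat \<Rightarrow> 'a set. A ` {1..t+1} \<subseteq> F \<longrightarrow> inj_on A {1..t+1} \<longrightarrow>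
        A 1 \<inter> (\<Union>i\<in>{2..t+1}. A i) \<noteq> {})"

text \<open>Meaningful for finite families only, where \<open>R = F\<close> shows that the minimum exists.\<close>

definition ell :: "'a set set \<Rightarrow> nat" where
  "ell F = (LEAST m. \<exists>R. R \<subseteq> F \<and> finite R \<and> card R = m \<and> intersecting (F - R))"

definition isomorphic_families :: "nat \<Rightarrow> nat set set \<Rightarrow> nat set set \<Rightarrow> bool" where
  "isomorphic_families n F G \<longleftrightarrow> (\<exists>\<sigma>. \<sigma> permutes {1..n} \<and> (\<lambda>A. \<sigma> ` A) ` F = G)"

text \<open>\<open>star_meeting n k A i\<close> is the family $\mathcal{S}_1(A_1,\ldots,A_i:1)$.\<close>

definition star_meeting :: "nat \<Rightarrow> nat \<Rightarrow> (nat \<Rightarrow> nat set) \<Rightarrow> nat \<Rightarrow> nat set set" where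
  "star_meeting n k A i = {C \<in> nsets {1..n} k. 1 \<in> C \<and> (\<forall>j\<in>{1..i}. C \<inter> A j \<noteq> {})}"

text \<open>The construction $\mathcal{J}^{1,t}_i$ involves choices (of the \<open>x j\<close>, of \<open>E\<close> and of the
  \<open>\<B> j\<close>), so it is a predicate on families. Injectivity of \<open>x\<close> together with
  \<open>x j \<noteq> 1\<close> says that \<open>J\<close> has \<open>i + 1\<close> elements.\<close>

definition is_J_family :: "nat \<Rightarrow> nat \<Rightarrow> nat \<Rightarrow> nat \<Rightarrow> nat set set \<Rightarrow> bool" where
  "is_J_family n k t i G \<longleftrightarrow> 1 \<le> i \<and> i \<le> k - 1 \<and>
     (\<exists>(x :: nat \<Rightarrow> nat) J E A \<B>.
        inj_on x {1..i} \<and> 1 \<notin> x ` {1..i} \<and>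
        J = insert 1 (x ` {1..i}) \<and> J \<subseteq> {1..n} \<and>
        E \<in> nsets ({1..n} - J) (k - 1) \<and>
        A = (\<lambda>j. insert (x j) E) \<and>
        (\<forall>j\<in>{1..i}. \<B> j \<subseteq> {B \<in> nsets {1..n} k. B \<inter> E = {} \<and> J - B = {x j}} \<and>
                    card (\<B> j) = t - 1) \<and>
        G = star_meeting n k A i \<union> A ` {1..i} \<union> (\<Union>j\<in>{1..i}. \<B> j))"

end

theory Submission imports Defs begin

text \<open>Every member of $F$ is disjoint from at most $t-1$ others. Call a pair heavy if it lies in more
  than about $k \binom{n-3}{k-3}$ members; then every member of $F$ meets every heavy pair, and any two heavy
  pairs meet. Fix disjoint $A, B \in F$. All but $2(t-1)$ members contain a pair from $A \times B$, so
  a family of the extremal order of magnitude $(k-1)\binom{n-2}{k-2}$ forces at least $k-1$ heavy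
  pairs there; they form a star with a centre $p$, and $k-1$ of its leaves form a set $E$. Each member avoiding
  $p$ contains $E$, hence is $A_v = E \cup \{v\}$ for some $v$ in a set $V$, and
  $|V| \ge \ell(F) \ge \gamma$. A member through $p$ meets $E$, or contains $V$, or is disjoint from
  some $A_v$; the last kind contributes at most $|V|(t-1)$ members. As $|V|$ is bounded, the total is
  maximal only for $|V| = \gamma$, and equality can then be read off.\<close>

section \<open>Counting k-sets with prescribed and forbidden points\<close>

text \<open>Deleting \<open>T\<close> is a bijection onto the \<open>(k - card T)\<close>-subsets of
  \<open>S - T - U\<close>. The exact star counts and the codegree bounds below are
  instances.\<close>

lemma card_nsets_between:
  assumes "finite S" "T \<subseteq> S" "U \<subseteq> S" "T \<inter> U = {}" "card T \<le> k"
  shows "card {C \<in> nsets S k. T \<subseteq> C \<and> C \<inter> U = {}} =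
    (card S - card T - card U) choose (k - card T)"
proof -
  have fin: "finite T" "finite U" using assms finite_subset[of _ S] by auto
  have "bij_betw (\<lambda>C. C - T) {C \<in> nsets S k. T \<subseteq> C \<and> C \<inter> U = {}} (nsets (S - T - U) (k - card T))"
  proof (rule bij_betw_byWitness[where f' = "\<lambda>D. D \<union> T"])
    show "(\<lambda>C. C - T) ` {C \<in> nsets S k. T \<subseteq> C \<and> C \<inter> U = {}} \<subseteq> nsets (S - T - U) (k - card T)"
      using fin by (auto simp: nsets_def card_Diff_subset)
    show "(\<lambda>D. D \<union> T) ` nsets (S - T - U) (k - card T) \<subseteq> {C \<in> nsets S k. T \<subseteq> C \<and> C \<inter> U = {}}"
    proof clarify
      fix D assume D: "D \<in> nsets (S - T - U) (k - card T)"
      then have "card (D \<union> T) = card D + card T"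
        using fin by (intro card_Un_disjoint) (auto simp: nsets_def)
      then show "D \<union> T \<in> nsets S k \<and> T \<subseteq> D \<union> T \<and> (D \<union> T) \<inter> U = {}"
        using D assms fin by (auto simp: nsets_def)
    qed
  qed (auto simp: nsets_def)
  then have "card {C \<in> nsets S k. T \<subseteq> C \<and> C \<inter> U = {}} = card (nsets (S - T - U) (k - card T))"
    by (rule bij_betw_same_card)
  also have "\<dots> = card (S - T - U) choose (k - card T)" by simp
  also have "card (S - T - U) = card S - card T - card U"
    using assms fin by (subst card_Diff_subset) (auto simp: card_Diff_subset)
  finally show ?thesis .
qed

lemma card_nsets_supset:
  assumes "finite S" "T \<subseteq> S" "card T \<le> k"
  shows "card {C \<in> nsets S k. T \<subseteq> C} = (card S - card T) choose (k - card T)"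
  using card_nsets_between[of S T "{}" k] assms by simp

lemma finite_nsets_subset: "finite S \<Longrightarrow> F \<subseteq> nsets S k \<Longrightarrow> finite F"
  by (meson finite_imp_finite_nsets finite_subset)

text \<open>Complementary counting: all k-sets through \<open>p\<close> minus those that also avoid
  \<open>E\<close>. With \<open>card E = k - 1\<close> this is the main term of the bound.\<close>

lemma card_star_hitting:
  assumes "finite S" "p \<in> S" "E \<subseteq> S - {p}" "k \<ge> 1"
  shows "card {C \<in> nsets S k. p \<in> C \<and> C \<inter> E \<noteq> {}} =
    ((card S - 1) choose (k - 1)) - ((card S - 1 - card E) choose (k - 1))"
proof -
  let ?P = "{C \<in> nsets S k. {p} \<subseteq> C}" and ?Q = "{C \<in> nsets S k. {p} \<subseteq> C \<and> C \<inter> E = {}}"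
  have "{C \<in> nsets S k. p \<in> C \<and> C \<inter> E \<noteq> {}} = ?P - ?Q" by auto
  moreover have "finite ?Q" by (rule finite_nsets_subset[OF assms(1)]) auto
  ultimately have "card {C \<in> nsets S k. p \<in> C \<and> C \<inter> E \<noteq> {}} = card ?P - card ?Q"
    by (simp only:) (rule card_Diff_subset, auto)
  also have "card ?P = (card S - 1) choose (k - 1)"
    using card_nsets_supset[of S "{p}" k] assms by simp
  also have "card ?Q = (card S - 1 - card E) choose (k - 1)"
    using card_nsets_between[of S "{p}" E k] assms by auto
  finally show ?thesis .
qed

text \<open>With \<open>card E = k - 1\<close> and \<open>card V = \<gamma>\<close> this is the
  second binomial term of the bound.\<close>

lemma card_star_missing:
  assumes "finite S" "p \<in> S" "E \<subseteq> S - {p}" "V \<subseteq> S - {p} - E" "card V < k"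
  shows "card {C \<in> nsets S k. p \<in> C \<and> C \<inter> E = {} \<and> V \<subseteq> C} =
    (card S - 1 - card E - card V) choose (k - card V - 1)"
proof -
  have "finite V" using assms(1,4) by (meson Diff_subset finite_subset)
  then have c: "card (insert p V) = Suc (card V)" using assms(4) by (subst card_insert_disjoint) auto
  have "{C \<in> nsets S k. p \<in> C \<and> C \<inter> E = {} \<and> V \<subseteq> C}
     = {C \<in> nsets S k. insert p V \<subseteq> C \<and> C \<inter> E = {}}" by auto
  then show ?thesis
    using card_nsets_between[of S "insert p V" E k] assms c
    by (auto simp: algebra_simps)
qed

subsection \<open>Disjointness degrees\<close>

text \<open>If \<open>t\<close> members were disjoint from \<open>X\<close>, then listing
  \<open>X\<close> first and these after it would give a forbidden sequence of \<open>t + 1\<close>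
  distinct members.\<close>

lemma union_intersecting_1_card_disjoint:
  assumes ui: "union_intersecting_1 t F" and F: "F \<subseteq> nsets S k" and "finite S" "k \<ge> 1" "t \<ge> 1" "X \<in> F"
  shows "card {Y \<in> F. X \<inter> Y = {}} \<le> t - 1"
proof (rule ccontr)
  assume "\<not> ?thesis"
  then have "t \<le> card {Y \<in> F. X \<inter> Y = {}}" by simp
  then obtain T where T: "T \<subseteq> {Y \<in> F. X \<inter> Y = {}}" "card T = t" "finite T"
    by (rule obtain_subset_with_card_n)
  have "card {2..t+1} = card T" using T by simp
  then obtain f where f: "bij_betw f {2..t+1} T"
    using T finite_same_card_bij[of "{2..t+1}" T] by auto
  \<comment> \<open>A nonempty set is not disjoint from itself, so \<open>X\<close> is not repeated
    in the sequence.\<close>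
  have X: "X \<noteq> {}" using \<open>X \<in> F\<close> F \<open>k \<ge> 1\<close> by (auto simp: nsets_def)
  then have "X \<notin> T" using T by auto
  define A where "A i = (if i = 1 then X else f i)" for i :: nat
  have eq: "{1..t+1} = insert 1 {2..t+1}" by auto
  have A: "A ` {2..t+1} = T" "inj_on A {2..t+1}"
  proof -
    have "A ` {2..t+1} = f ` {2..t+1}" by (intro image_cong) (auto simp: A_def)
    then show "A ` {2..t+1} = T" using f by (simp add: bij_betw_def)
    have "inj_on A {2..t+1} = inj_on f {2..t+1}" by (intro inj_on_cong) (auto simp: A_def)
    then show "inj_on A {2..t+1}" using f by (simp add: bij_betw_def)
  qed
  have "A ` {1..t+1} \<subseteq> F"
    unfolding eq using A T \<open>X \<in> F\<close> by (auto simp: A_def)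
  moreover have "inj_on A {1..t+1}"
  proof -
    have "A 1 \<notin> A ` ({2..t+1} - {1})"
      using A(1) \<open>X \<notin> T\<close> by (metis A_def Diff_iff image_iff)
    then show ?thesis unfolding eq using A by (simp only: inj_on_insert simp_thms)
  qed
  ultimately have "A 1 \<inter> (\<Union>i\<in>{2..t+1}. A i) \<noteq> {}"
    using ui unfolding union_intersecting_1_def by blast
  then show False using A(1) T(1) by (auto simp: A_def)
qed

text \<open>Deleting the members that avoid \<open>p\<close> leaves a star, which is intersecting.
  This turns the hypothesis on \<open>ell F\<close> into a lower bound on the number of members off
  the centre.\<close>

lemma ell_le_card_avoiding:
  assumes "finite F"
  shows "ell F \<le> card {X \<in> F. p \<notin> X}"
  unfolding ell_def
proof (rule Least_le, intro exI conjI)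
  show "intersecting (F - {X \<in> F. p \<notin> X})" by (auto simp: intersecting_def)
qed (use assms in auto)

text \<open>Used in contrapositive form: a positive \<open>ell F\<close> yields a disjoint pair in
  \<open>F\<close>.\<close>

lemma ell_intersecting: "intersecting F \<Longrightarrow> ell F = 0"
  unfolding ell_def by (rule Least_eq_0) (auto intro!: exI[of _ "{}"])

subsection \<open>Heavy pairs\<close>

text \<open>For fixed \<open>k\<close> this is one power of \<open>card S\<close> below the codegree
  bound for pairs; heaviness exploits that gap.\<close>

lemma card_codegree_3:
  assumes F: "F \<subseteq> nsets S k" and "finite S" "k \<ge> 3" "p \<noteq> q" "x \<noteq> p" "x \<noteq> q"
  shows "card {C \<in> F. p \<in> C \<and> q \<in> C \<and> x \<in> C} \<le> (card S - 3) choose (k - 3)"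
proof (cases "{p,q,x} \<subseteq> S")
  case True
  have "card {C \<in> F. p \<in> C \<and> q \<in> C \<and> x \<in> C} \<le> card {C \<in> nsets S k. {p,q,x} \<subseteq> C}"
    using F by (intro card_mono finite_nsets_subset[OF \<open>finite S\<close>]) auto
  also have "\<dots> = (card S - 3) choose (k - 3)"
    using card_nsets_supset[of S "{p,q,x}" k] True assms by (simp add: eval_nat_numeral)
  finally show ?thesis .
next
  case False
  then have "{C \<in> F. p \<in> C \<and> q \<in> C \<and> x \<in> C} = {}" using F by (auto simp: nsets_def)
  then show ?thesis by (simp only: card.empty)
qed

lemma card_codegree_2:
  assumes F: "F \<subseteq> nsets S k" and "finite S" "k \<ge> 2" "p \<noteq> q"
  shows "card {C \<in> F. p \<in> C \<and> q \<in> C} \<le> (card S - 2) choose (k - 2)"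
proof (cases "{p,q} \<subseteq> S")
  case True
  have "card {C \<in> F. p \<in> C \<and> q \<in> C} \<le> card {C \<in> nsets S k. {p,q} \<subseteq> C}"
    using F by (intro card_mono finite_nsets_subset[OF \<open>finite S\<close>]) auto
  also have "\<dots> = (card S - 2) choose (k - 2)"
    using card_nsets_supset[of S "{p,q}" k] True assms by (simp add: eval_nat_numeral)
  finally show ?thesis .
next
  case False
  then have "{C \<in> F. p \<in> C \<and> q \<in> C} = {}" using F by (auto simp: nsets_def)
  then show ?thesis by (simp only: card.empty)
qed

text \<open>If \<open>X\<close> misses both points, a member through the pair is either disjoint
  from \<open>X\<close> (at most \<open>t - 1\<close> of these) or contains one of the
  \<open>k\<close> points of \<open>X\<close> as a third point. The heaviness threshold is the least
  number exceeding the resulting total by one.\<close>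

lemma heavy_pair_hits:
  assumes F: "F \<subseteq> nsets S k" and S: "finite S" and k: "k \<ge> 3" and t: "t \<ge> 1"
    and deg: "\<And>X. X \<in> F \<Longrightarrow> card {Y \<in> F. X \<inter> Y = {}} \<le> t - 1"
    and heavy: "card {C \<in> F. p \<in> C \<and> q \<in> C} \<ge> k * ((card S - 3) choose (k - 3)) + t" and "p \<noteq> q"
    and X: "X \<in> F"
  shows "p \<in> X \<or> q \<in> X"
proof (rule ccontr)
  assume n: "\<not> ?thesis"
  have finF: "finite F" using finite_nsets_subset F S by blast
  have finX: "finite X" and cX: "card X = k" using F X by (auto simp: nsets_def)
  let ?D = "\<Union>x\<in>X. {C \<in> F. p \<in> C \<and> q \<in> C \<and> x \<in> C}"
  have "card {C \<in> F. p \<in> C \<and> q \<in> C} \<le> card ({Y \<in> F. X \<inter> Y = {}} \<union> ?D)"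
    using finF finX by (intro card_mono) auto
  also have "\<dots> \<le> card {Y \<in> F. X \<inter> Y = {}} + card ?D" by (rule card_Un_le)
  also have "card ?D \<le> (\<Sum>x\<in>X. card {C \<in> F. p \<in> C \<and> q \<in> C \<and> x \<in> C})"
    using finX by (rule card_UN_le)
  also have "\<dots> \<le> (\<Sum>x\<in>X. (card S - 3) choose (k - 3))"
    using n \<open>p \<noteq> q\<close> by (intro sum_mono card_codegree_3[OF F S k]) auto
  also have "\<dots> = k * ((card S - 3) choose (k - 3))" using cX by simp
  finally show False using deg[OF X] heavy t by linarith
qed

text \<open>Every member meets the heavy pair \<open>{c, d}\<close>. If this is disjoint from
  \<open>{a, b}\<close>, each member through \<open>a\<close> and \<open>b\<close> contains a third
  point \<open>c\<close> or \<open>d\<close>, so two three-point codegrees bound their number below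
  the threshold.\<close>

lemma heavy_pairs_meet:
  assumes F: "F \<subseteq> nsets S k" and S: "finite S" and k: "k \<ge> 3" and t: "t \<ge> 1"
    and deg: "\<And>X. X \<in> F \<Longrightarrow> card {Y \<in> F. X \<inter> Y = {}} \<le> t - 1"
    and h1: "card {C \<in> F. a \<in> C \<and> b \<in> C} \<ge> k * ((card S - 3) choose (k - 3)) + t" and "a \<noteq> b"
    and h2: "card {C \<in> F. c \<in> C \<and> d \<in> C} \<ge> k * ((card S - 3) choose (k - 3)) + t" and "c \<noteq> d"
  shows "{a, b} \<inter> {c, d} \<noteq> {}"
proof
  assume dis: "{a, b} \<inter> {c, d} = {}"
  have finF: "finite F" using finite_nsets_subset F S by blast
  have "{C \<in> F. a \<in> C \<and> b \<in> C} \<subseteq> {C \<in> F. a \<in> C \<and> b \<in> C \<and> c \<in> C} \<union> {C \<in> F. a \<in> C \<and> b \<in> C \<and> d \<in> C}"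
    using heavy_pair_hits[OF F S k t deg h2 \<open>c \<noteq> d\<close>] by auto
  then have "card {C \<in> F. a \<in> C \<and> b \<in> C} \<le>
      card ({C \<in> F. a \<in> C \<and> b \<in> C \<and> c \<in> C} \<union> {C \<in> F. a \<in> C \<and> b \<in> C \<and> d \<in> C})"
    using finF by (intro card_mono) auto
  also have "\<dots> \<le> card {C \<in> F. a \<in> C \<and> b \<in> C \<and> c \<in> C} + card {C \<in> F. a \<in> C \<and> b \<in> C \<and> d \<in> C}"
    by (rule card_Un_le)
  also have "\<dots> \<le> 2 * ((card S - 3) choose (k - 3))"
    using card_codegree_3[OF F S k \<open>a \<noteq> b\<close>, of c] card_codegree_3[OF F S k \<open>a \<noteq> b\<close>, of d] dis by auto
  also have "\<dots> < k * ((card S - 3) choose (k - 3)) + t"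
  proof -
    have "2 * ((card S - 3) choose (k - 3)) \<le> k * ((card S - 3) choose (k - 3))"
      using k by (intro mult_right_mono) auto
    then show ?thesis using t by linarith
  qed
  finally show False using h1 by simp
qed

section \<open>Binomial estimates for large n\<close>

text \<open>Telescoping Pascal's rule writes the difference as the sum of
  \<open>(N - s) choose r\<close> for \<open>s\<close> from 1 to \<open>m\<close>; the last summand
  is the smallest.\<close>

lemma binomial_diff_upper:
  "m * ((N - m) choose r) \<le> (N choose Suc r) - ((N - m) choose Suc r)" if "m \<le> N"
  using that
proof (induction m)
  case (Suc m)
  then obtain M where M: "N - m = Suc M" "N - Suc m = M"
    by (metis Suc_diff_Suc Suc_le_lessD)
  have le: "M choose r \<le> Suc M choose r" by (rule binomial_right_mono) simp
  have "(M choose r) + (M choose Suc r) = Suc M choose Suc r" by simp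
  moreover have "Suc M choose Suc r \<le> N choose Suc r"
    using M by (intro binomial_right_mono) auto
  moreover have "m * (M choose r) \<le> m * (Suc M choose r)" using le by simp
  moreover have "m * (Suc M choose r) \<le> (N choose Suc r) - (Suc M choose Suc r)"
    using Suc M by simp
  ultimately show ?case unfolding M mult_Suc by linarith
qed simp

text \<open>The same telescoping sum, now bounded through its largest summand.\<close>

lemma binomial_drop_le:
  "(N choose Suc r) \<le> ((N - m) choose Suc r) + m * ((N - 1) choose r)" if "m \<le> N"
  using that
proof (induction m)
  case (Suc m)
  then obtain M where M: "N - m = Suc M" "N - Suc m = M"
    by (metis Suc_diff_Suc Suc_le_lessD)
  have "M choose r \<le> (N - 1) choose r" using M by (intro binomial_right_mono) auto
  moreover have "(M choose r) + (M choose Suc r) = Suc M choose Suc r" by simp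
  ultimately show ?case using Suc M by simp
qed simp

text \<open>Growth that is at least linear in \<open>N\<close> suffices later, where a binomial
  coefficient has to beat a constant.\<close>

lemma binomial_ge_diff:
  assumes "1 \<le> r" "r \<le> N" shows "N - r + 1 \<le> N choose r"
proof -
  have "N - r + 1 = (N - r + 1) choose 1" by simp
  also have "\<dots> = Suc (N - r) choose (N - r)" by simp
  also have "\<dots> \<le> N choose (N - r)"
    using assms by (intro binomial_right_mono) auto
  also have "\<dots> = N choose r" using binomial_symmetric[OF assms(2)] by (rule sym)
  finally show ?thesis .
qed

text \<open>The left side bounds a family with at most \<open>k - 2\<close> heavy pairs in
  \<open>A \<times> B\<close>. The right side is about \<open>k - 1\<close> copies of
  \<open>(n - 2) choose (k - 2)\<close>, and the one extra copy absorbs all terms of lower order in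
  \<open>n\<close>.\<close>

lemma heavy_count_estimate:
  fixes n k t :: nat
  assumes k: "k \<ge> 3" and n: "n \<ge> k * (k^3 + k^2 * (t + 1) + 2 * t + 1) + 2"
  shows "2 * t + (k - 2) * ((n - 2) choose (k - 2)) + k^2 * (k * ((n - 3) choose (k - 3)) + t)
     < ((n - 1) choose (k - 1)) - ((n - k) choose (k - 1))"
proof -
  obtain j where j: "k = j + 3" using k by (metis add.commute le_Suc_ex)
  define c where "c = (n - 3) choose j"
  \<comment> \<open>\<open>K\<close> collects what one copy must absorb, in units of
    \<open>c\<close>: \<open>k^3\<close> and \<open>k^2 * t\<close> from the light pairs,
    \<open>k^2\<close> from passing between \<open>n - k\<close> and \<open>n - 2\<close>,
    \<open>2 * t\<close> from members missing \<open>A\<close> or \<open>B\<close>, and 1 for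
    strictness.\<close>
  define K where "K = k^3 + k^2 * (t + 1) + 2 * t + 1"
  have nK: "n \<ge> k * K + 2" using n by (simp only: K_def)
  have "1 \<le> K" unfolding K_def by simp
  then have "k * 1 \<le> k * K" by (rule mult_le_mono2)
  then have nk: "n \<ge> k + 2" using nK by linarith
  have c1: "c \<ge> 1" using nk by (simp add: c_def j Suc_le_eq)
  \<comment> \<open>Absorption shows that the copy exceeds \<open>c\<close> by a factor linear in
    \<open>n\<close>; the bound on \<open>n\<close> makes this factor at least
    \<open>K\<close>.\<close>
  have "Suc j * ((n - 2) choose Suc j) = (n - 2) * c"
    using binomial_absorption[of j "n - 2"] by (simp add: c_def)
  moreover have "Suc j * (K * c) \<le> (n - 2) * c"
  proof -
    have "Suc j * K \<le> k * K" by (intro mult_right_mono) (auto simp: j)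
    then have "Suc j * K \<le> n - 2" using nK by linarith
    then have "(Suc j * K) * c \<le> (n - 2) * c" by (rule mult_right_mono) simp
    then show ?thesis by (simp only: mult.assoc)
  qed
  ultimately have big: "K * c \<le> (n - 2) choose Suc j"
    by (metis mult_le_cancel1 zero_less_Suc)
  have lo: "(k - 1) * ((n - k) choose Suc j) \<le> ((n - 1) choose (k - 1)) - ((n - k) choose (k - 1))"
  proof -
    have "n - 1 - (k - 1) = n - k" "Suc (Suc j) = k - 1" "k - 1 \<le> n - 1" using nk by (auto simp: j)
    then show ?thesis using binomial_diff_upper[of "k - 1" "n - 1" "Suc j"] by simp
  qed
  have "(n - 2) choose Suc j \<le> ((n - k) choose Suc j) + (k - 2) * c"
  proof -
    have "n - 2 - (k - 2) = n - k" "n - 2 - 1 = n - 3" "k - 2 \<le> n - 2" using nk k by auto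
    then show ?thesis using binomial_drop_le[of "k - 2" "n - 2" j] by (simp only: c_def)
  qed
  then have "(k - 1) * ((n - 2) choose Suc j) \<le> (k - 1) * ((n - k) choose Suc j) + (k - 1) * (k - 2) * c"
    by (metis add_mult_distrib2 mult.assoc mult_le_mono2)
  moreover have "(k - 1) * (k - 2) * c \<le> k^2 * c"
    by (simp add: power2_eq_square mult_le_mono)
  moreover have "(k - 1) * ((n - 2) choose Suc j) = (k - 2) * ((n - 2) choose Suc j) + ((n - 2) choose Suc j)"
    by (simp add: j)
  moreover have "K * c = k^2 * (k * c) + k^2 * c + (k^2 * t) * c + (2 * t) * c + c"
    by (simp add: K_def algebra_simps power2_eq_square power3_eq_cube)
  moreover have "(k^2 * t) * c \<ge> k^2 * t" "(2 * t) * c \<ge> 2 * t" using c1 by auto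
  moreover have "k^2 * (k * c + t) = k^2 * (k * c) + k^2 * t" by (rule add_mult_distrib2)
  ultimately have "2 * t + (k - 2) * ((n - 2) choose Suc j) + k^2 * (k * c + t)
      < (k - 1) * ((n - k) choose Suc j)"
    using big c1 by linarith
  moreover have "k - 2 = Suc j" "k - 3 = j" by (auto simp: j)
  ultimately show ?thesis using lo by (simp add: c_def)
qed

section \<open>Finding the centre\<close>

text \<open>Pairwise meeting edges form a star or a triangle, and a bipartite graph has no triangle.
  Concretely, an edge leaving row \<open>a\<close> lies in column \<open>b\<close>, an edge leaving
  column \<open>b\<close> lies in row \<open>a\<close>, and two such edges would not meet.\<close>

lemma pairwise_meeting_star:
  assumes "\<And>a b c d. (a,b) \<in> R \<Longrightarrow> (c,d) \<in> R \<Longrightarrow> a = c \<or> b = d"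
  shows "(\<exists>a. \<forall>s\<in>R. fst s = a) \<or> (\<exists>b. \<forall>s\<in>R. snd s = b)"
proof (rule ccontr)
  assume n: "\<not> ?thesis"
  then obtain a b where ab: "(a,b) \<in> R" by auto
  obtain c d where cd: "(c,d) \<in> R" "c \<noteq> a" using n by (metis surj_pair fst_conv)
  obtain e f where ef: "(e,f) \<in> R" "f \<noteq> b" using n by (metis surj_pair snd_conv)
  show False using assms[OF ab cd(1)] assms[OF ab ef(1)] assms[OF cd(1) ef(1)] cd ef by auto
qed

lemma exists_centre:
  assumes F: "F \<subseteq> nsets S k" and S: "finite S" "card S = n" and k: "k \<ge> 3" and t: "t \<ge> 1"
    and n: "n \<ge> k * (k^3 + k^2 * (t + 1) + 2 * t + 1) + 2"
    and deg: "\<And>X. X \<in> F \<Longrightarrow> card {Y \<in> F. X \<inter> Y = {}} \<le> t - 1"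
    and nint: "\<not> intersecting F"
    and large: "card F \<ge> ((n - 1) choose (k - 1)) - ((n - k) choose (k - 1))"
  obtains p E where "p \<in> S" "E \<in> nsets (S - {p}) (k - 1)" "\<And>X. X \<in> F \<Longrightarrow> p \<notin> X \<Longrightarrow> E \<subseteq> X"
proof -
  have finF: "finite F" using finite_nsets_subset F S by blast
  obtain A B where A: "A \<in> F" and B: "B \<in> F" and AB: "A \<inter> B = {}"
    using nint by (auto simp: intersecting_def)
  have A': "A \<subseteq> S" "finite A" "card A = k" and B': "B \<subseteq> S" "finite B" "card B = k"
    using A B F by (auto simp: nsets_def)
  define w where "w = k * ((n - 3) choose (k - 3)) + t"
  define cd where "cd s = card {C \<in> F. fst s \<in> C \<and> snd s \<in> C}" for s
  define R where "R = {s \<in> A \<times> B. w \<le> cd s}"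
  have finR: "finite R" using A' B' by (auto simp: R_def)
  have ne: "a \<noteq> b" if "(a, b) \<in> A \<times> B" for a b using that AB by auto
  have hits: "a \<in> X \<or> b \<in> X" if "(a, b) \<in> R" "X \<in> F" for a b X
    using heavy_pair_hits[OF F S(1) k t deg _ _ that(2), of a b] that ne S(2)
    by (auto simp: R_def w_def cd_def)
  have meet: "a = c \<or> b = d" if "(a, b) \<in> R" "(c, d) \<in> R" for a b c d
    using heavy_pairs_meet[OF F S(1) k t deg, of a b c d] that ne S(2) AB
    by (auto simp: R_def w_def cd_def)
  have cardR: "k - 1 \<le> card R"
  proof (rule ccontr)
    assume "\<not> ?thesis"
    then have r: "card R \<le> k - 2" by simp
    have cov: "F \<subseteq> {Y \<in> F. A \<inter> Y = {}} \<union> {Y \<in> F. B \<inter> Y = {}} \<union>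
        (\<Union>s\<in>A \<times> B. {C \<in> F. fst s \<in> C \<and> snd s \<in> C})" by fastforce
    have "card F \<le> card ({Y \<in> F. A \<inter> Y = {}} \<union> {Y \<in> F. B \<inter> Y = {}} \<union>
        (\<Union>s\<in>A \<times> B. {C \<in> F. fst s \<in> C \<and> snd s \<in> C}))"
      using finF A' B' by (intro card_mono[OF _ cov]) auto
    also have "\<dots> \<le> card {Y \<in> F. A \<inter> Y = {}} + card {Y \<in> F. B \<inter> Y = {}} +
        card (\<Union>s\<in>A \<times> B. {C \<in> F. fst s \<in> C \<and> snd s \<in> C})"
      by (meson add_right_mono card_Un_le le_trans)
    also have "card (\<Union>s\<in>A \<times> B. {C \<in> F. fst s \<in> C \<and> snd s \<in> C}) \<le> (\<Sum>s\<in>A \<times> B. cd s)"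
      unfolding cd_def using A' B' by (intro card_UN_le) auto
    \<comment> \<open>Heavy pairs are few and get the trivial codegree bound; each of the at most
      \<open>k^2\<close> light pairs contributes at most \<open>w\<close>.\<close>
    also have "(\<Sum>s\<in>A \<times> B. cd s) = (\<Sum>s\<in>R. cd s) + (\<Sum>s\<in>A \<times> B - R. cd s)"
      using A' B' by (subst add.commute, intro sum.subset_diff) (auto simp: R_def)
    also have "(\<Sum>s\<in>R. cd s) \<le> (\<Sum>s\<in>R. (n - 2) choose (k - 2))"
    proof (rule sum_mono)
      fix s assume "s \<in> R"
      then have "fst s \<noteq> snd s" using ne[of "fst s" "snd s"] by (auto simp: R_def)
      then show "cd s \<le> (n - 2) choose (k - 2)"
        using card_codegree_2[OF F S(1), of "fst s" "snd s"] k S(2) by (auto simp: cd_def)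
    qed
    also have "\<dots> \<le> (k - 2) * ((n - 2) choose (k - 2))" using r by simp
    also have "(\<Sum>s\<in>A \<times> B - R. cd s) \<le> (\<Sum>s\<in>A \<times> B - R. w)"
      by (intro sum_mono) (auto simp: R_def)
    also have "\<dots> \<le> k^2 * w"
    proof -
      have "card (A \<times> B - R) \<le> card (A \<times> B)" using A' B' by (intro card_mono) auto
      then show ?thesis using A' B' by (simp add: card_cartesian_product power2_eq_square)
    qed
    finally have "card F \<le> 2 * t + (k - 2) * ((n - 2) choose (k - 2)) + k^2 * w"
      using deg[OF A] deg[OF B] by linarith
    then show False using heavy_count_estimate[OF k n] large by (simp add: w_def)
  qed
  consider a where "\<forall>s\<in>R. fst s = a" | b where "\<forall>s\<in>R. snd s = b"
    using pairwise_meeting_star[of R] meet by blast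
  then show thesis
  proof cases
    case (1 a)
    have "inj_on snd R" using 1 by (intro inj_onI) (metis prod.expand)
    then have "k - 1 \<le> card (snd ` R)" using cardR by (simp add: card_image)
    \<comment> \<open>There may be \<open>k\<close> leaves. Exactly \<open>k - 1\<close> are kept,
      so that a k-set containing \<open>E\<close> has one further point.\<close>
    then obtain E where E: "E \<subseteq> snd ` R" "card E = k - 1" "finite E"
      by (rule obtain_subset_with_card_n)
    have "R \<noteq> {}" using cardR k by auto
    then have a: "a \<in> A" using 1 by (auto simp: R_def)
    have EB: "E \<subseteq> B" using E by (auto simp: R_def)
    show thesis
    proof (rule that[of a E])
      show "E \<in> nsets (S - {a}) (k - 1)" using E EB a B' AB by (auto simp: nsets_def)
      show "E \<subseteq> X" if "X \<in> F" "a \<notin> X" for X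
      proof
        fix b assume "b \<in> E"
        then have "(a, b) \<in> R" using E(1) 1 by fastforce
        then show "b \<in> X" using hits that by blast
      qed
    qed (use a A' in auto)
  next
    \<comment> \<open>The mirror image: the centre lies in \<open>B\<close> and the leaves in
      \<open>A\<close>.\<close>
    case (2 b)
    have "inj_on fst R" using 2 by (intro inj_onI) (metis prod.expand)
    then have "k - 1 \<le> card (fst ` R)" using cardR by (simp add: card_image)
    then obtain E where E: "E \<subseteq> fst ` R" "card E = k - 1" "finite E"
      by (rule obtain_subset_with_card_n)
    have "R \<noteq> {}" using cardR k by auto
    then have b: "b \<in> B" using 2 by (auto simp: R_def)
    have EA: "E \<subseteq> A" using E by (auto simp: R_def)
    show thesis
    proof (rule that[of b E])
      show "E \<in> nsets (S - {b}) (k - 1)" using E EA b A' AB by (auto simp: nsets_def)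
      show "E \<subseteq> X" if "X \<in> F" "b \<notin> X" for X
      proof
        fix a assume "a \<in> E"
        then have "(a, b) \<in> R" using E(1) 2 by fastforce
        then show "a \<in> X" using hits that by blast
      qed
    qed (use b B' in auto)
  qed
qed

subsection \<open>Counting around the centre\<close>

text \<open>With the centre normalised to 1, \<open>F\<close> is covered by four families whose
  sizes are controlled by \<open>m = card V\<close>. For \<open>m = \<gamma>\<close> the bounds add
  up to \<open>M\<close>, for larger \<open>m\<close> they stay below, and equality forces the cover
  to be exact.\<close>

lemma star_structure:
  assumes F: "F \<subseteq> nsets {1..n} k" and t: "t \<ge> 1" and g: "1 \<le> \<gamma>" "\<gamma> + 2 \<le> k"
    and n: "n \<ge> 2 * k + (t + k) * t"
    and E: "E \<in> nsets ({1..n} - {1}) (k - 1)"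
    and cont: "\<And>X. X \<in> F \<Longrightarrow> 1 \<notin> X \<Longrightarrow> E \<subseteq> X"
    and deg: "\<And>X. X \<in> F \<Longrightarrow> card {Y \<in> F. X \<inter> Y = {}} \<le> t - 1"
    and nint: "\<not> intersecting F" and many: "\<gamma> \<le> card {X \<in> F. 1 \<notin> X}"
    and M: "M = ((n - 1) choose (k - 1)) - ((n - k) choose (k - 1))
                 + ((n - k - \<gamma>) choose (k - \<gamma> - 1)) + \<gamma> * t"
  shows "card F \<le> M" and "card F = M \<Longrightarrow> is_J_family n k t \<gamma> F"
proof -
  let ?S = "{1..n}"
  have finF: "finite F" using finite_nsets_subset[OF _ F] by simp
  have E': "E \<subseteq> ?S - {1}" "finite E" "card E = k - 1" using E by (auto simp: nsets_def)
  then have Ene: "E \<noteq> {}" using g by auto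
  have oneS: "1 \<in> ?S" using n g by auto
  define A where "A v = insert v E" for v
  define V where "V = {v \<in> ?S - {1} - E. A v \<in> F}"
  define m where "m = card V"
  define D where "D v = {Y \<in> F. A v \<inter> Y = {}}" for v
  \<comment> \<open>\<open>P\<close> and \<open>Q\<close> range over all k-sets and together form
    the star of sets through 1 meeting every \<open>A v\<close>. \<open>R\<close> and
    \<open>N\<close> consist of members of \<open>F\<close>: those disjoint from some
    \<open>A v\<close>, and those avoiding 1.\<close>
  define P where "P = {C \<in> nsets ?S k. 1 \<in> C \<and> C \<inter> E \<noteq> {}}"
  define Q where "Q = {C \<in> nsets ?S k. 1 \<in> C \<and> C \<inter> E = {} \<and> V \<subseteq> C}"
  define R where "R = (\<Union>v\<in>V. D v)"
  define N where "N = {X \<in> F. 1 \<notin> X}"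
  have V: "V \<subseteq> ?S - {1} - E" "finite V" by (auto simp: V_def)
  have injA: "inj_on A V" using V by (auto simp: inj_on_def A_def)
  have N: "N = A ` V"
  proof
    show "A ` V \<subseteq> N" using V E' by (auto simp: N_def V_def A_def)
    show "N \<subseteq> A ` V"
    proof
      fix X assume X: "X \<in> N"
      then have "E \<subseteq> X" "X \<subseteq> ?S" "finite X" "card X = k" using cont F by (auto simp: N_def nsets_def)
      then have "card (X - E) = 1" using E' g by (simp add: card_Diff_subset)
      then obtain v where "X - E = {v}" by (auto simp: card_1_singleton_iff)
      then have v: "X = A v" "v \<notin> E" "v \<in> X" using \<open>E \<subseteq> X\<close> by (auto simp: A_def)
      then have "v \<in> V" using X \<open>X \<subseteq> ?S\<close> by (auto simp: V_def N_def)
      then show "X \<in> A ` V" using v by simp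
    qed
  qed
  have cardN: "card N = m" by (simp add: N m_def card_image[OF injA])
  \<comment> \<open>A member avoiding 1 contains the nonempty set \<open>E\<close> and therefore
    meets every \<open>A v\<close>.\<close>
  have D1: "1 \<in> C" if "C \<in> D v" for C v
    using that cont[of C] Ene by (auto simp: D_def A_def)
  have cD: "card (D v) \<le> t - 1" if "v \<in> V" for v
    using deg[of "A v"] that by (auto simp: D_def V_def)
  have finD: "finite (D v)" for v using finF by (simp add: D_def)
  have finR: "finite R" using V finD by (simp add: R_def)
  have finPQ: "finite P" "finite Q"
    by (rule finite_nsets_subset[of ?S _ k]; auto simp: P_def Q_def)+
  have cR: "card R \<le> (\<Sum>v\<in>V. card (D v))" unfolding R_def using V by (intro card_UN_le)
  have cD_sum: "(\<Sum>v\<in>V. card (D v)) \<le> m * (t - 1)"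
    unfolding m_def using sum_bounded_above[of V "\<lambda>v. card (D v)" "t - 1"] cD by simp
  \<comment> \<open>A member through 1 that misses \<open>E\<close> and some \<open>v\<close> in
    \<open>V\<close> is disjoint from \<open>A v\<close>, hence in \<open>R\<close>.\<close>
  have cov: "F \<subseteq> P \<union> Q \<union> R \<union> N"
    using F by (auto simp: P_def Q_def R_def N_def D_def A_def V_def)
  have finU: "finite (P \<union> Q \<union> R \<union> N)" using finPQ finR finF by (simp add: N_def)
  have cU: "card (P \<union> Q \<union> R \<union> N) \<le> card P + card Q + card R + m"
    using card_Un_le[of "P \<union> Q \<union> R" N] card_Un_le[of "P \<union> Q" R] card_Un_le[of P Q] cardN
    by linarith
  have cF: "card F \<le> card P + card Q + card R + m"
    using card_mono[OF finU cov] cU by linarith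
  have cP: "card P = ((n - 1) choose (k - 1)) - ((n - k) choose (k - 1))"
    using card_star_hitting[of ?S 1 E k] oneS E' g by (simp add: P_def)
  have m_ge: "\<gamma> \<le> m" using many cardN by (simp add: N_def)
  have tm: "m * (t - 1) + m = m * t" using t by (metis Suc_pred' add.commute less_le_trans mult_Suc_right zero_less_one)
  \<comment> \<open>Some member through \<open>1\<close> is disjoint from \<open>E\<close>, hence from every \<open>A v\<close> with \<open>v\<close> outside it.\<close>
  have m_le: "m \<le> t + k"
  proof -
    obtain X Y where XY: "X \<in> F" "Y \<in> F" "X \<inter> Y = {}" using nint by (auto simp: intersecting_def)
    \<comment> \<open>Two members through 1 meet, so one of \<open>X\<close> and \<open>Y\<close>
      avoids 1 and has the form \<open>A v\<close>.\<close>
    have "\<exists>v\<in>V. D v \<noteq> {}"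
    proof (cases "X \<in> N")
      case True
      then show ?thesis using XY by (auto simp: N D_def)
    next
      case False
      then have "Y \<in> N" using XY by (auto simp: N_def)
      then show ?thesis using XY by (fastforce simp: N D_def)
    qed
    then obtain v C where vC: "v \<in> V" "C \<in> D v" by auto
    then have C: "C \<in> F" "C \<inter> E = {}" "finite C" "card C = k" using F by (auto simp: D_def A_def nsets_def)
    have "A ` (V - C) \<subseteq> {Y \<in> F. C \<inter> Y = {}}" using C by (auto simp: A_def V_def)
    then have "card (A ` (V - C)) \<le> t - 1"
      using deg[OF C(1)] card_mono[of "{Y \<in> F. C \<inter> Y = {}}" "A ` (V - C)"] finF by fastforce
    moreover have "card (A ` (V - C)) = card (V - C)"
      using injA by (intro card_image) (auto simp: inj_on_def)
    moreover have "m \<le> card (V - C) + card C"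
      unfolding m_def using diff_card_le_card_Diff[OF C(3), of V] by linarith
    ultimately show ?thesis using C t by linarith
  qed
  \<comment> \<open>A further point in \<open>V\<close> costs \<open>Q\<close> at least
    \<open>i choose Suc j\<close> sets, by Pascal's rule. This is at least
    \<open>i - j = n - 2 * k + 1\<close>, which exceeds \<open>(t + k) * t\<close> and thus the
    contribution \<open>m * t\<close> of \<open>R\<close> and \<open>N\<close>.\<close>
  have strict: "card F < M" if "m \<noteq> \<gamma>"
  proof -
    have "\<gamma> + 1 \<le> card V" using that m_ge by (simp add: m_def)
    then obtain W where W: "W \<subseteq> V" "card W = \<gamma> + 1" "finite W"
      by (rule obtain_subset_with_card_n)
    have "card Q \<le> card {C \<in> nsets ?S k. 1 \<in> C \<and> C \<inter> E = {} \<and> W \<subseteq> C}"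
      using W by (intro card_mono finite_nsets_subset[of ?S _ k]) (auto simp: Q_def)
    also have "\<dots> = (n - 1 - (k - 1) - (\<gamma> + 1)) choose (k - (\<gamma> + 1) - 1)"
      using card_star_missing[of ?S 1 E W k] W V E' g oneS by auto
    finally have "card Q \<le> (n - 1 - (k - 1) - (\<gamma> + 1)) choose (k - (\<gamma> + 1) - 1)" .
    moreover obtain j where j: "k = \<gamma> + j + 2" using g by (metis add.commute add.left_commute le_Suc_ex)
    moreover have "k + \<gamma> + 1 \<le> n" using n g by linarith
    moreover from this obtain i where i: "n = k + \<gamma> + 1 + i" using le_Suc_ex by blast
    ultimately have "card Q \<le> i choose j" by simp
    moreover have "(n - k - \<gamma>) choose (k - \<gamma> - 1) = (i choose j) + (i choose Suc j)"
      by (simp add: i j)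
    moreover have "i choose Suc j \<ge> i - Suc j + 1"
      using n by (intro binomial_ge_diff) (auto simp: i j)
    moreover have "m * t \<le> (t + k) * t" using m_le by simp
    moreover have "i - Suc j + 1 > (t + k) * t" using n by (auto simp: i j)
    ultimately show ?thesis
      using cF cR cD_sum tm cP unfolding M by linarith
  qed
  have Qeq: "card Q = (n - k - \<gamma>) choose (k - \<gamma> - 1)" if "m = \<gamma>"
    using card_star_missing[of ?S 1 E V k] V E' g oneS that by (simp add: Q_def m_def)
  have le: "card P + card Q + m * (t - 1) + m = M" if "m = \<gamma>"
    using Qeq that cP tm unfolding M by simp
  show "card F \<le> M"
    using strict le cF cR cD_sum by (cases "m = \<gamma>") auto
  assume eq: "card F = M"
  then have m: "m = \<gamma>" using strict by auto
  \<comment> \<open>From here on every inequality of the count is tight: \<open>F\<close> fills the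
    cover, each \<open>D v\<close> has its maximal size, and the \<open>D v\<close> are pairwise
    disjoint.\<close>
  have Rcard: "card R = m * (t - 1)" using cF cR cD_sum le[OF m] eq by linarith
  have full: "F = P \<union> Q \<union> R \<union> N"
  proof (rule card_subset_eq[OF finU cov])
    show "card F = card (P \<union> Q \<union> R \<union> N)"
      using card_mono[OF finU cov] cU Rcard le[OF m] eq by linarith
  qed
  have sumD: "(\<Sum>v\<in>V. card (D v)) = m * (t - 1)" using Rcard cR cD_sum by simp
  have cDeq: "card (D v) = t - 1" if "v \<in> V" for v
  proof (rule ccontr)
    assume "card (D v) \<noteq> t - 1"
    then have "card (D v) < t - 1" using cD[OF that] by linarith
    then have "(\<Sum>v\<in>V. card (D v)) < (\<Sum>v\<in>V. t - 1)"
      using cD that V by (intro sum_strict_mono_ex1) blast+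
    then show False using sumD by (simp add: m_def)
  qed
  have disD: "D v \<inter> D w = {}" if "v \<in> V" "w \<in> V" "v \<noteq> w" for v w
  proof -
    \<comment> \<open>Replacing \<open>D w\<close> by \<open>D w - D v\<close> does not change the
      union, so an overlap would make \<open>R\<close> smaller than the sum of the sizes.\<close>
    have "card R \<le> card (\<Union>u\<in>V - {w}. D u) + card (D w - D v)"
    proof -
      have "R \<subseteq> (\<Union>u\<in>V - {w}. D u) \<union> (D w - D v)" using that by (auto simp: R_def)
      then have "card R \<le> card ((\<Union>u\<in>V - {w}. D u) \<union> (D w - D v))"
        using finD V by (intro card_mono) auto
      then show ?thesis using card_Un_le le_trans by blast
    qed
    also have "card (\<Union>u\<in>V - {w}. D u) \<le> (\<Sum>u\<in>V - {w}. card (D u))"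
      using V by (intro card_UN_le) auto
    finally have "(\<Sum>v\<in>V. card (D v)) \<le> (\<Sum>u\<in>V - {w}. card (D u)) + card (D w - D v)"
      using Rcard sumD by simp
    moreover have "(\<Sum>v\<in>V. card (D v)) = card (D w) + (\<Sum>u\<in>V - {w}. card (D u))"
      using V that by (intro sum.remove) auto
    ultimately have "card (D w) \<le> card (D w - D v)" by simp
    then have "D w - D v = D w" using finD by (intro card_seteq) auto
    then show ?thesis by auto
  qed
  obtain x where x: "bij_betw x {1..\<gamma>} V"
    using ex_bij_betw_nat_finite_1[OF V(2)] m by (auto simp: m_def)
  then have ximg: "x ` {1..\<gamma>} = V" and xinj: "inj_on x {1..\<gamma>}" by (auto simp: bij_betw_def)
  have xV: "x j \<in> V" if "j \<in> {1..\<gamma>}" for j using ximg that by blast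
  let ?J = "insert 1 V"
  show "is_J_family n k t \<gamma> F"
    unfolding is_J_family_def
  proof (rule conjI[OF _ conjI], goal_cases _ _ choices)
    case choices
    show ?case
    \<comment> \<open>The families required by the construction are the members of \<open>F\<close>
      disjoint from \<open>A (x j)\<close>.\<close>
    proof (rule exI[of _ x], rule exI[of _ ?J], rule exI[of _ E], rule exI[of _ "\<lambda>j. A (x j)"],
        rule exI[of _ "\<lambda>j. D (x j)"], intro conjI ballI)
      show "inj_on x {1..\<gamma>}" by (rule xinj)
      show "1 \<notin> x ` {1..\<gamma>}" "?J = insert 1 (x ` {1..\<gamma>})" "?J \<subseteq> ?S" using V oneS unfolding ximg by auto
      show "E \<in> nsets (?S - ?J) (k - 1)" using E V by (auto simp: nsets_def)
      show "(\<lambda>j. A (x j)) = (\<lambda>j. insert (x j) E)" by (simp add: A_def)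
      show "card (D (x j)) = t - 1" if "j \<in> {1..\<gamma>}" for j using cDeq xV that by blast
      show "D (x j) \<subseteq> {B \<in> nsets ?S k. B \<inter> E = {} \<and> ?J - B = {x j}}" if "j \<in> {1..\<gamma>}" for j
      proof
        fix B assume B: "B \<in> D (x j)"
        then have B': "B \<in> F" "B \<inter> E = {}" "x j \<notin> B" "1 \<in> B" using D1 by (auto simp: D_def A_def)
        \<comment> \<open>If \<open>B\<close> also missed \<open>w\<close>, it would lie in both
          \<open>D w\<close> and \<open>D (x j)\<close>.\<close>
        have "w \<in> B" if "w \<in> V" "w \<noteq> x j" for w
          using disD[of w "x j"] xV[OF \<open>j \<in> {1..\<gamma>}\<close>] that B B' by (auto simp: D_def A_def)
        then show "B \<in> {B \<in> nsets ?S k. B \<inter> E = {} \<and> ?J - B = {x j}}"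
          using B' F xV[OF that] by auto
      qed
      have "star_meeting n k (\<lambda>j. A (x j)) \<gamma> = P \<union> Q"
      proof -
        \<comment> \<open>A set missing \<open>E\<close> meets every \<open>A v\<close> only by
          containing all of \<open>V\<close>.\<close>
        have "(\<forall>j\<in>{1..\<gamma>}. C \<inter> A (x j) \<noteq> {}) \<longleftrightarrow> (\<forall>v\<in>V. C \<inter> A v \<noteq> {})" for C
          by (simp add: ximg[symmetric])
        moreover have "(\<forall>v\<in>V. C \<inter> A v \<noteq> {}) \<longleftrightarrow> C \<inter> E \<noteq> {} \<or> V \<subseteq> C" for C
          by (auto simp: A_def)
        ultimately show ?thesis by (auto simp: star_meeting_def P_def Q_def)
      qed
      moreover have "(\<lambda>j. A (x j)) ` {1..\<gamma>} = N" by (simp add: N ximg[symmetric] image_image)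
      moreover have "(\<Union>j\<in>{1..\<gamma>}. D (x j)) = R" by (simp add: R_def ximg[symmetric])
      ultimately show "F = star_meeting n k (\<lambda>j. A (x j)) \<gamma> \<union> (\<lambda>j. A (x j)) ` {1..\<gamma>} \<union> (\<Union>j\<in>{1..\<gamma>}. D (x j))"
        using full by auto
    qed
  qed (use g in auto)
qed

section \<open>Size of the extremal families\<close>

text \<open>All pieces are disjoint: the \<open>A j\<close> avoid 1, a set in \<open>B j\<close>
  contains 1 but misses \<open>A j\<close>, and \<open>J - C\<close> tells the different
  \<open>B j\<close> apart. The star splits into \<open>P\<close> and \<open>Q\<close> as
  before.\<close>

lemma card_J_family:
  assumes G: "is_J_family n k t i G" and t: "t \<ge> 1"
  shows "card G = ((n - 1) choose (k - 1)) - ((n - k) choose (k - 1))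
                 + ((n - k - i) choose (k - i - 1)) + i * t"
proof -
  let ?S = "{1..n}"
  obtain x J E A B where i: "1 \<le> i" "i \<le> k - 1" and x: "inj_on x {1..i}" "1 \<notin> x ` {1..i}"
    and J: "J = insert 1 (x ` {1..i})" "J \<subseteq> ?S" and E: "E \<in> nsets (?S - J) (k - 1)"
    and A: "A = (\<lambda>j. insert (x j) E)"
    and B': "\<forall>j\<in>{1..i}. B j \<subseteq> {B \<in> nsets ?S k. B \<inter> E = {} \<and> J - B = {x j}} \<and> card (B j) = t - 1"
    and Geq: "G = star_meeting n k A i \<union> A ` {1..i} \<union> (\<Union>j\<in>{1..i}. B j)"
    using G unfolding is_J_family_def by (elim conjE exE) (rule that; assumption)
  have B: "B j \<subseteq> {B \<in> nsets ?S k. B \<inter> E = {} \<and> J - B = {x j}}" "card (B j) = t - 1"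
    if "j \<in> {1..i}" for j using B' that by auto
  let ?V = "x ` {1..i}"
  have E': "E \<subseteq> ?S - {1}" "finite E" "card E = k - 1" "E \<inter> ?V = {}" "1 \<notin> E"
    using E J by (auto simp: nsets_def)
  have cV: "card ?V = i" using x by (simp add: card_image)
  have V: "?V \<subseteq> ?S - {1} - E" using J x E' by (auto simp del: One_nat_def)
  have oneS: "1 \<in> ?S" using J by auto
  define P where "P = {C \<in> nsets ?S k. 1 \<in> C \<and> C \<inter> E \<noteq> {}}"
  define Q where "Q = {C \<in> nsets ?S k. 1 \<in> C \<and> C \<inter> E = {} \<and> ?V \<subseteq> C}"
  have finPQ: "finite P" "finite Q"
    by (rule finite_nsets_subset[of ?S _ k]; auto simp: P_def Q_def)+
  have finB: "finite (B j)" if "j \<in> {1..i}" for j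
    by (rule finite_nsets_subset[of ?S _ k]) (use B(1)[OF that] in auto)
  \<comment> \<open>\<open>J - C\<close> consists of \<open>x j\<close> alone, which differs from
    1.\<close>
  have one: "1 \<in> C" if "C \<in> B j" "j \<in> {1..i}" for C j
    using B(1)[OF that(2)] that x J by blast
  have miss: "C \<inter> E = {}" "J - C = {x j}" if "C \<in> B j" "j \<in> {1..i}" for C j
    using B(1)[OF that(2)] that by auto
  have S: "star_meeting n k A i = P \<union> Q"
    by (auto simp: star_meeting_def P_def Q_def A)
  have cP: "card P = ((n - 1) choose (k - 1)) - ((n - k) choose (k - 1))"
    using card_star_hitting[of ?S 1 E k] oneS E' i by (simp add: P_def)
  have cQ: "card Q = (n - k - i) choose (k - i - 1)"
    using card_star_missing[of ?S 1 E ?V k] V E' i oneS cV by (simp add: Q_def)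
  have cS: "card (star_meeting n k A i) = card P + card Q"
    unfolding S by (rule card_Un_disjoint[OF finPQ]) (auto simp: P_def Q_def)
  have injA: "inj_on A {1..i}"
  proof (rule inj_onI)
    fix a b assume ab: "a \<in> {1..i}" "b \<in> {1..i}" "A a = A b"
    then have "x a = x b" using E'(4) unfolding A by blast
    then show "a = b" using ab x by (auto dest: inj_onD)
  qed
  have cA: "card (A ` {1..i}) = i" using injA by (simp add: card_image)
  have cB: "card (\<Union>j\<in>{1..i}. B j) = i * (t - 1)"
  proof (subst card_UN_disjoint)
    show "\<forall>a\<in>{1..i}. \<forall>b\<in>{1..i}. a \<noteq> b \<longrightarrow> B a \<inter> B b = {}"
    proof (intro ballI impI)
      fix a b assume ab: "a \<in> {1..i}" "b \<in> {1..i}" "a \<noteq> b"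
      then have "x a \<noteq> x b" using x by (auto dest: inj_onD)
      then show "B a \<inter> B b = {}" using miss(2) ab by blast
    qed
  qed (use finB B in auto)
  have "card (A ` {1..i} \<union> (\<Union>j\<in>{1..i}. B j)) = i + i * (t - 1)"
  proof (subst card_Un_disjoint)
    have "1 \<notin> A j" if "j \<in> {1..i}" for j using that x E' by (auto simp: A)
    then show "A ` {1..i} \<inter> (\<Union>j\<in>{1..i}. B j) = {}" using one by blast
  qed (use finB cA cB in auto)
  moreover have "card G = card (star_meeting n k A i) + card (A ` {1..i} \<union> (\<Union>j\<in>{1..i}. B j))"
    unfolding Geq Un_assoc
  proof (rule card_Un_disjoint)
    have 1: "1 \<notin> A j" if "j \<in> {1..i}" for j using that x E' by (auto simp: A)
    have "C \<notin> star_meeting n k A i" if "C \<in> B j" "j \<in> {1..i}" for C j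
    proof -
      have "C \<inter> A j = {}" using miss[OF that] by (auto simp: A)
      then show ?thesis using that by (auto simp: star_meeting_def)
    qed
    moreover have "A j \<notin> star_meeting n k A i" if "j \<in> {1..i}" for j
      using 1[OF that] by (simp add: star_meeting_def)
    ultimately show "star_meeting n k A i \<inter> (A ` {1..i} \<union> (\<Union>j\<in>{1..i}. B j)) = {}" by blast
  qed (use finB finPQ S in auto)
  moreover have "i + i * (t - 1) = i * t" using t by (cases t) auto
  ultimately show ?thesis using cS cP cQ by simp
qed

section \<open>Moving the centre to 1 and combining the two directions\<close>

theorem theorem2:
  fixes k t \<beta> \<gamma> :: nat
  assumes "k \<ge> 5" and "t \<ge> 1" and "\<gamma> = 1 + \<beta>" and "\<gamma> \<le> k - 2"
  shows "\<exists>n\<^sub>0. \<forall>n\<ge>n\<^sub>0. \<forall>F :: nat set set.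
    F \<subseteq> nsets {1..n} k \<longrightarrow> union_intersecting_1 t F \<longrightarrow> ell F \<ge> \<gamma> \<longrightarrow>
      card F \<le> ((n - 1) choose (k - 1)) - ((n - k) choose (k - 1))
                 + ((n - k - \<gamma>) choose (k - \<gamma> - 1)) + \<gamma> * t \<and>
      (card F = ((n - 1) choose (k - 1)) - ((n - k) choose (k - 1))
                 + ((n - k - \<gamma>) choose (k - \<gamma> - 1)) + \<gamma> * t
        \<longleftrightarrow> (\<exists>G. is_J_family n k t \<gamma> G \<and> isomorphic_families n F G))"
proof (intro exI allI impI)
  fix n and F :: "nat set set"
  \<comment> \<open>The first summand serves the search for the centre, the second the comparison of
    \<open>m\<close> with \<open>\<gamma>\<close>.\<close>
  assume n: "n \<ge> (k * (k^3 + k^2 * (t + 1) + 2 * t + 1) + 2) + (2 * k + (t + k) * t)"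
    and F: "F \<subseteq> nsets {1..n} k" and ui: "union_intersecting_1 t F" and ell: "ell F \<ge> \<gamma>"
  define M where "M = ((n - 1) choose (k - 1)) - ((n - k) choose (k - 1))
                 + ((n - k - \<gamma>) choose (k - \<gamma> - 1)) + \<gamma> * t"
  have finF: "finite F" using finite_nsets_subset[OF _ F] by simp
  have deg: "card {Y \<in> F. X \<inter> Y = {}} \<le> t - 1" if "X \<in> F" for X
    using union_intersecting_1_card_disjoint[OF ui F _ _ _ that] assms by simp
  have nint: "\<not> intersecting F" using ell ell_intersecting assms by fastforce
  have iso_card: "card F = M" if "is_J_family n k t \<gamma> G" "isomorphic_families n F G" for G
  proof -
    obtain \<sigma> where \<sigma>: "\<sigma> permutes {1..n}" "(\<lambda>A. \<sigma> ` A) ` F = G"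
      using \<open>isomorphic_families n F G\<close> by (auto simp: isomorphic_families_def)
    have "inj_on ((`) \<sigma>) F" using permutes_inj[OF \<sigma>(1)] by (simp add: inj_on_def inj_image_eq_iff)
    then have "card G = card F" using \<sigma>(2) card_image by blast
    then show ?thesis using card_J_family[OF that(1)] assms by (simp add: M_def)
  qed
  \<comment> \<open>Below \<open>M\<close> the bound is immediate, and \<open>iso_card\<close>
    excludes an isomorphic extremal family. Only large families need the structure.\<close>
  have main: "card F \<le> M \<and> (card F = M \<longrightarrow> (\<exists>G. is_J_family n k t \<gamma> G \<and> isomorphic_families n F G))"
    if large: "M \<le> card F"
  proof -
    have "card F \<ge> ((n - 1) choose (k - 1)) - ((n - k) choose (k - 1))"
      using large by (simp add: M_def)
    then obtain p E where p: "p \<in> {1..n}" and E: "E \<in> nsets ({1..n} - {p}) (k - 1)"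
      and cont: "\<And>X. X \<in> F \<Longrightarrow> p \<notin> X \<Longrightarrow> E \<subseteq> X"
      using exists_centre[OF F _ _ _ _ _ deg nint, of n] n assms by auto
    have one: "1 \<in> {1..n}" using p by auto
    \<comment> \<open>Swapping \<open>p\<close> with 1 preserves all properties required by
      \<open>star_structure\<close>, and the same permutation witnesses the isomorphism.\<close>
    define \<sigma> where "\<sigma> = transpose p (1::nat)"
    have \<sigma>: "\<sigma> permutes {1..n}" using permutes_swap_id[OF p one] by (simp add: \<sigma>_def)
    have inj: "inj \<sigma>" using permutes_inj[OF \<sigma>] .
    have \<sigma>p: "\<sigma> p = 1" by (simp add: \<sigma>_def)
    let ?G = "(\<lambda>A. \<sigma> ` A) ` F"
    have injF: "inj_on ((`) \<sigma>) H" for H using inj by (simp add: inj_on_def inj_image_eq_iff)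
    have cardG: "card ?G = card F" using injF by (rule card_image)
    have mem1: "1 \<in> \<sigma> ` X \<longleftrightarrow> p \<in> X" for X using inj_image_mem_iff[OF inj, of p X] \<sigma>p by simp
    have disj: "\<sigma> ` X \<inter> \<sigma> ` Y = {} \<longleftrightarrow> X \<inter> Y = {}" for X Y
      using image_Int[OF inj, of X Y] by auto
    have cim: "card (\<sigma> ` X) = card X" for X using inj by (meson card_image inj_on_subset subset_UNIV)
    have "?G \<subseteq> nsets {1..n} k"
    proof -
      have "\<sigma> ` X \<in> nsets {1..n} k" if "X \<in> nsets {1..n} k" for X
        using image_mono[of X "{1..n}" \<sigma>] permutes_image[OF \<sigma>] that by (simp add: nsets_def cim)
      then show ?thesis using F by blast
    qed
    moreover have "\<sigma> ` E \<in> nsets ({1..n} - {1}) (k - 1)"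
    proof -
      have "\<sigma> ` ({1..n} - {p}) = {1..n} - {1}"
        using permutes_image[OF \<sigma>] \<sigma>p by (simp add: image_set_diff[OF inj])
      then show ?thesis using E by (auto simp: nsets_def cim)
    qed
    moreover have "\<sigma> ` E \<subseteq> X" if "X \<in> ?G" "1 \<notin> X" for X
      using that cont mem1 by auto
    moreover have "card {Y \<in> ?G. X \<inter> Y = {}} \<le> t - 1" if XG: "X \<in> ?G" for X
    proof -
      obtain Z where Z: "Z \<in> F" "X = \<sigma> ` Z" using XG by auto
      have "{Y \<in> ?G. X \<inter> Y = {}} = (\<lambda>A. \<sigma> ` A) ` {Y \<in> F. Z \<inter> Y = {}}"
        unfolding Z(2) using disj by auto
      then show ?thesis using deg[OF Z(1)] by (simp add: card_image[OF injF])
    qed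
    moreover have "\<not> intersecting ?G"
      using nint disj by (auto simp: intersecting_def)
    moreover have "\<gamma> \<le> card {X \<in> ?G. 1 \<notin> X}"
    proof -
      have "{X \<in> ?G. 1 \<notin> X} = (\<lambda>A. \<sigma> ` A) ` {X \<in> F. p \<notin> X}" using mem1 by auto
      then have "card {X \<in> ?G. 1 \<notin> X} = card {X \<in> F. p \<notin> X}" by (simp add: card_image[OF injF])
      then show ?thesis using ell_le_card_avoiding[OF finF, of p] ell by simp
    qed
    moreover have "1 \<le> \<gamma>" "\<gamma> + 2 \<le> k" "n \<ge> 2 * k + (t + k) * t" using assms n by auto
    ultimately have "card ?G \<le> M" "card ?G = M \<Longrightarrow> is_J_family n k t \<gamma> ?G"
      using star_structure[of ?G n k t \<gamma> "\<sigma> ` E" M] assms(2) M_def by blast+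
    then show ?thesis using \<sigma> cardG by (auto simp: isomorphic_families_def)
  qed
  have "card F \<le> M \<and> (card F = M \<longleftrightarrow> (\<exists>G. is_J_family n k t \<gamma> G \<and> isomorphic_families n F G))"
    using main iso_card by (meson linear order_refl)
  then show "card F \<le> ((n - 1) choose (k - 1)) - ((n - k) choose (k - 1))
                 + ((n - k - \<gamma>) choose (k - \<gamma> - 1)) + \<gamma> * t \<and>
      (card F = ((n - 1) choose (k - 1)) - ((n - k) choose (k - 1))
                 + ((n - k - \<gamma>) choose (k - \<gamma> - 1)) + \<gamma> * t
        \<longleftrightarrow> (\<exists>G. is_J_family n k t \<gamma> G \<and> isomorphic_families n F G))"
    unfolding M_def .
qed

end
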